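(* Let $v=(v_{ij})_{1\le i<j\le 4}$ be an interior point of the discrete Plücker set $\mathrm{Pl}_{4,2}(\mathbb{Z})$ with two adjacent coordinates equal to $1$, i.e. $v_{ij}=v_{ik}=1$ for some pairwise distinct $i,j,k\in\{1,2,3,4\}$. Then $v\in\mathcal{V}^{\rm sf}_{4,2}(\mathbb{Z})$, i.e. there exist lattice polytopes $P_1,\dots,P_4$ in $\mathbb{R}^2$ such that $v_{ij}=V(P_i,P_j)$ for all $1\leq i<j\leq 4$.
   Context: A lattice polytope in $\mathbb{R}^2$ is the convex hull of a nonempty finite subset of $\mathbb{Z}^2$ (points and segments are allowed). For lattice polytopes $P,Q$ in $\mathbb{R}^2$ the normalized mixed area is $V(P,Q)=\frac12\left(\mathrm{Vol}_2(P+Q)-\mathrm{Vol}_2(P)-\mathrm{Vol}_2(Q)\right)$, where $P+Q$ is the Minkowski sum and $\mathrm{Vol}_2$ is twice the Euclidean area. Square-free quadratic forms $\sum_{1\le i<j\le 4}v_{ij}x_ix_j$ are identified with their coefficient vectors $v=(v_{ij})_{1\le i<j\le 4}$, with the convention $v_{ji}=v_{ij}$. The discrete Plücker set $\mathrm{Pl}_{4,2}(\mathbb{Z})$ is the set of all such $v$ with $v_{ij}\in\mathbb{Z}_{\geq 0}$ satisfying the three Plücker-type inequalities $$v_{12}v_{34}+v_{13}v_{24}\geq v_{14}v_{23},\quad v_{13}v_{24}+v_{14}v_{23}\geq v_{12}v_{34},\quad v_{14}v_{23}+v_{12}v_{34}\geq v_{13}v_{24}.$$ A point $v\in\mathrm{Pl}_{4,2}(\mathbb{Z})$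 is a boundary point if at least one of these inequalities is an equality at $v$; otherwise it is an interior point. The set $\mathcal{V}^{\rm sf}_{4,2}(\mathbb{Z})$ consists of all $v$ of the form $v_{ij}=V(P_i,P_j)$, $1\le i<j\le 4$, for lattice polytopes $P_1,\dots,P_4$ in $\mathbb{R}^2$. Viewing the $v_{ij}$ as weights on the edges $\{i,j\}$ of the complete graph on $\{1,2,3,4\}$, two coordinates are adjacent if the corresponding edges share a node. *)

theory Defs
  imports "HOL-Analysis.Analysis"
begin

definition lattice_polytope :: "(real^2) set \<Rightarrow> bool" where
  "lattice_polytope P \<longleftrightarrow>
     (\<exists>S. finite S \<and> S \<noteq> {} \<and> (\<forall>x\<in>S. \<forall>c. x $ c \<in> \<int>) \<and> P = convex hull S)"

definition Vol2 :: "(real^2) set \<Rightarrow> real" where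
  "Vol2 P = 2 * measure lebesgue P"

text \<open>The sum of two sets is the Minkowski sum (from Set_Algebras).\<close>

definition mixed_area :: "(real^2) set \<Rightarrow> (real^2) set \<Rightarrow> real" where
  "mixed_area P Q = (Vol2 (P + Q) - Vol2 P - Vol2 Q) / 2"

text \<open>
  A square-free quadratic form in four variables is given by its coefficient vector, a weight
  function on the edges of the complete graph on {1,2,3,4}. The coefficient \<open>v\<^sub>i\<^sub>j\<close> is
  \<open>v {i, j}\<close>, which builds in the convention \<open>v\<^sub>j\<^sub>i = v\<^sub>i\<^sub>j\<close>. Values of the function at sets
  other than the six edges are irrelevant, and no definition below constrains them.
\<close>

type_synonym coeffs = "nat set \<Rightarrow> real"

definition Pl42 :: "coeffs set" where
  "Pl42 = {v.
     (\<forall>i\<in>{1..4}. \<forall>j\<in>{1..4}. i < j \<longrightarrow> v {i, j} \<in> \<int> \<and> v {i, j} \<ge> 0) \<and>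
     v {1,2} * v {3,4} + v {1,3} * v {2,4} \<ge> v {1,4} * v {2,3} \<and>
     v {1,3} * v {2,4} + v {1,4} * v {2,3} \<ge> v {1,2} * v {3,4} \<and>
     v {1,4} * v {2,3} + v {1,2} * v {3,4} \<ge> v {1,3} * v {2,4}}"

definition boundary_Pl42 :: "coeffs set" where
  "boundary_Pl42 = {v \<in> Pl42.
     v {1,2} * v {3,4} + v {1,3} * v {2,4} = v {1,4} * v {2,3} \<or>
     v {1,3} * v {2,4} + v {1,4} * v {2,3} = v {1,2} * v {3,4} \<or>
     v {1,4} * v {2,3} + v {1,2} * v {3,4} = v {1,3} * v {2,4}}"

definition interior_Pl42 :: "coeffs set" where
  "interior_Pl42 = Pl42 - boundary_Pl42"

definition Vsf42 :: "coeffs set" where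
  "Vsf42 = {v. \<exists>P :: nat \<Rightarrow> (real^2) set.
     (\<forall>i\<in>{1..4}. lattice_polytope (P i)) \<and>
     (\<forall>i\<in>{1..4}. \<forall>j\<in>{1..4}. i < j \<longrightarrow> v {i, j} = mixed_area (P i) (P j))}"

end

theory Submission
  imports Defs
begin

text \<open>
  The mixed area of a segment \<open>[0, u]\<close> with a polygon is the width of the polygon in the
  direction \<open>det(u, \<cdot>)\<close>. Label the nodes so that \<open>v\<^sub>i\<^sub>j = v\<^sub>i\<^sub>k = 1\<close> and put \<open>d = v\<^sub>j\<^sub>k\<close>,
  \<open>a = v\<^sub>i\<^sub>l\<close>, \<open>b = v\<^sub>j\<^sub>l\<close>, \<open>c = v\<^sub>k\<^sub>l\<close>, where \<open>b \<le> c\<close> by symmetry. The segments from \<open>0\<close> to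
  \<open>(1,0)\<close>, \<open>(d,1)\<close>, \<open>(0,1)\<close> realise \<open>1, 1, d\<close>, so what is needed is a lattice polygon of height
  \<open>a\<close>, width \<open>c\<close> and width \<open>b\<close> in the direction \<open>d y - x\<close>. The Pluecker inequalities say that
  \<open>b\<close>, \<open>c\<close>, \<open>a d\<close> satisfy the triangle inequalities, and the triangle \<open>(0,0), (t,0), (c,a)\<close> has
  these widths for \<open>t = b + c - a d\<close> if \<open>c \<le> a d\<close>, and for \<open>t = b\<close> otherwise.
\<close>

section \<open>The determinant form det(u, x) on the plane\<close>

definition cross2 :: "real^2 \<Rightarrow> real^2 \<Rightarrow> real" where
  "cross2 u x = u $ 1 * x $ 2 - u $ 2 * x $ 1"

lemma cross2_simps:
  "cross2 u (x + y) = cross2 u x + cross2 u y"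
  "cross2 u (x - y) = cross2 u x - cross2 u y"
  "cross2 u (c *\<^sub>R x) = c * cross2 u x"
  "cross2 (- u) x = - cross2 u x"
  "cross2 u u = 0"
  "cross2 u 0 = 0"
  by (simp_all add: cross2_def algebra_simps)

lemma negligible_cross2_level:
  assumes "u \<noteq> 0"
  shows "negligible {x. cross2 u x = r}"
proof -
  have "{x. cross2 u x = r} = {x. vector [- u $ 2, u $ 1] \<bullet> x = r}"
    by (simp add: cross2_def inner_vec_def sum_2)
  moreover have "(vector [- u $ 2, u $ 1] :: real^2) \<noteq> 0"
    using assms by (auto simp: vec_eq_iff forall_2)
  ultimately show ?thesis
    by (simp add: negligible_hyperplane)
qed

lemma cross2_eq_0_imp_scaleR:
  assumes "u \<noteq> 0" "cross2 u w = 0"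
  obtains s where "w = s *\<^sub>R u"
proof (cases "u $ 1 = 0")
  case True
  then have "u $ 2 \<noteq> 0" using assms(1) by (auto simp: vec_eq_iff forall_2)
  then have "w = (w $ 2 / u $ 2) *\<^sub>R u"
    using assms(2) True by (auto simp: vec_eq_iff forall_2 cross2_def field_simps)
  then show ?thesis by (rule that)
next
  case False
  then have "w = (w $ 1 / u $ 1) *\<^sub>R u"
    using assms(2) by (auto simp: vec_eq_iff forall_2 cross2_def field_simps)
  then show ?thesis by (rule that)
qed

section \<open>Areas of Minkowski sums with a segment\<close>

lemma lmeasurable_hull_plus_segment:
  fixes u :: "real^2"
  assumes "finite S"
  shows "convex hull S + closed_segment a u \<in> lmeasurable"
proof -
  have "convex hull S + closed_segment a u = convex hull (S + {a, u})"
    by (simp add: convex_hull_set_plus segment_convex_hull)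
  then show ?thesis
    using assms by (simp add: lmeasurable_compact finite_imp_compact_convex_hull finite_set_plus)
qed

text \<open>The sum is a translate of the image of the unit square under the linear map with columns
  \<open>C - A\<close> and \<open>u\<close>. The determinant formula also covers the degenerate case
  of parallel segments.\<close>

lemma measure_parallelogram:
  fixes A C u :: "real^2"
  shows "measure lebesgue (closed_segment A C + closed_segment 0 u) = \<bar>cross2 u (C - A)\<bar>"
proof -
  define f where "f = (\<lambda>x :: real^2. x $ 1 *\<^sub>R (C - A) + x $ 2 *\<^sub>R u)"
  have lin: "linear f"
    by (intro linearI) (simp_all add: f_def algebra_simps)
  have "closed_segment A C + closed_segment 0 u = (+) A ` f ` cbox 0 1"
  proof (intro equalityI subsetI)
    fix x assume "x \<in> closed_segment A C + closed_segment 0 u"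
    then obtain p q where "0 \<le> p" "p \<le> 1" "0 \<le> q" "q \<le> 1"
      "x = ((1 - p) *\<^sub>R A + p *\<^sub>R C) + q *\<^sub>R u"
      by (auto simp: set_plus_def closed_segment_def)
    then have "x = A + f (vector [p, q])" "vector [p, q] \<in> cbox (0 :: real^2) 1"
      by (auto simp: f_def mem_box_cart forall_2 algebra_simps)
    then show "x \<in> (+) A ` f ` cbox 0 1" by blast
  next
    fix x assume "x \<in> (+) A ` f ` cbox 0 1"
    then obtain y where y: "y \<in> cbox 0 1" "x = A + f y" by blast
    then have "x = ((1 - y $ 1) *\<^sub>R A + y $ 1 *\<^sub>R C) + y $ 2 *\<^sub>R u"
      by (simp add: f_def algebra_simps)
    moreover have "(1 - y $ 1) *\<^sub>R A + y $ 1 *\<^sub>R C \<in> closed_segment A C"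
      using y by (auto simp: closed_segment_def mem_box_cart forall_2)
    moreover have "y $ 2 *\<^sub>R u \<in> closed_segment 0 u"
      using y by (auto simp: closed_segment_def mem_box_cart forall_2)
    ultimately show "x \<in> closed_segment A C + closed_segment 0 u"
      by (simp add: set_plus_intro)
  qed
  then have "measure lebesgue (closed_segment A C + closed_segment 0 u) =
      measure lebesgue (f ` cbox 0 1)"
    by (simp only: measure_translation)
  also have "\<dots> = \<bar>det (matrix f)\<bar> * measure lebesgue (cbox 0 (1 :: real^2))"
    by (rule measure_linear_image[OF lin]) simp
  also have "measure lebesgue (cbox 0 (1 :: real^2)) = 1"
    using content_cbox_cart[of "0 :: real^2" 1] by (simp add: interval_ne_empty_cart)
  also have "\<bar>det (matrix f)\<bar> * 1 = \<bar>cross2 u (C - A)\<bar>"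
    by (simp add: det_2 matrix_def f_def axis_def cross2_def algebra_simps)
  finally show ?thesis .
qed

text \<open>The segment pushes the edge \<open>A C\<close> away from \<open>B\<close>, so the sum is the triangle
  together with the parallelogram over that edge.\<close>

lemma measure_triangle_plus_segment_aux:
  fixes A B C u :: "real^2"
  assumes B: "B = (1 - m) *\<^sub>R A + m *\<^sub>R C - l *\<^sub>R u" and m: "0 \<le> m" "m \<le> 1" and l: "0 \<le> l"
    and AC: "cross2 u A < cross2 u C"
  shows "measure lebesgue (convex hull {A, B, C} + closed_segment 0 u) =
    measure lebesgue (convex hull {A, B, C}) + (cross2 u C - cross2 u A)"
proof -
  let ?T = "convex hull {A, B, C}" and ?S = "closed_segment 0 u"
  let ?R = "closed_segment A C + ?S"
  have u: "u \<noteq> 0" using AC by (auto simp: cross2_def)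
  \<comment> \<open>By the form of \<open>B\<close>, every point of the triangle is a point of the
    edge \<open>A C\<close> moved back by \<open>p * l\<close> along \<open>u\<close>, where
    \<open>p\<close> is its barycentric weight at \<open>B\<close>. The last clause says that the
    way from there to the edge stays in the triangle.\<close>
  have T_form: "\<exists>q p. 0 \<le> q \<and> q \<le> 1 \<and> 0 \<le> p \<and> p \<le> 1 \<and>
      x = (1 - q) *\<^sub>R A + q *\<^sub>R C - (p * l) *\<^sub>R u \<and>
      (\<forall>p'. 0 \<le> p' \<longrightarrow> p' \<le> p \<longrightarrow> (1 - q) *\<^sub>R A + q *\<^sub>R C - (p' * l) *\<^sub>R u \<in> ?T)"
    if x: "x \<in> ?T" for x
  proof -
    obtain a b c where abc: "0 \<le> a" "0 \<le> b" "0 \<le> c" "a + b + c = 1"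
      and x: "x = a *\<^sub>R A + b *\<^sub>R B + c *\<^sub>R C"
      using x by (auto simp: convex_hull_3)
    let ?q = "c + b * m"
    have bm: "0 \<le> b * m" "b * m \<le> b" using abc m by (auto intro: mult_left_le)
    have a: "a = 1 - b - c" using abc by simp
    have "(1 - ?q) *\<^sub>R A + ?q *\<^sub>R C - (p' * l) *\<^sub>R u \<in> ?T" if p': "0 \<le> p'" "p' \<le> b" for p'
    proof -
      \<comment> \<open>The weight \<open>b - p'\<close> taken from \<open>B\<close> goes to
        \<open>A\<close> and \<open>C\<close> in the ratio \<open>1 - m\<close> to \<open>m\<close>,
        which amounts to a shift along \<open>u\<close> only.\<close>
      let ?c = "c + (b - p') * m" and ?a = "a + (b - p') * (1 - m)"
      have "(1 - ?q) *\<^sub>R A + ?q *\<^sub>R C - (p' * l) *\<^sub>R u = ?a *\<^sub>R A + p' *\<^sub>R B + ?c *\<^sub>R C"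
        by (simp add: B a algebra_simps)
      moreover have "?a + p' + ?c = 1" by (simp add: a algebra_simps)
      moreover have "0 \<le> ?a" "0 \<le> ?c" using abc m p' by auto
      ultimately show ?thesis using p' unfolding convex_hull_3 by blast
    qed
    moreover have "x = (1 - ?q) *\<^sub>R A + ?q *\<^sub>R C - (b * l) *\<^sub>R u"
      by (simp add: x B a algebra_simps)
    ultimately show ?thesis using abc bm
      by (intro exI[of _ ?q] exI[of _ b]) auto
  qed
  have "?T + ?S = ?T \<union> ?R"
  proof (intro equalityI subsetI)
    fix z assume "z \<in> ?T + ?S"
    then obtain x s where x: "x \<in> ?T" and s: "0 \<le> s" "s \<le> 1" and z: "z = x + s *\<^sub>R u"
      by (auto simp: set_plus_def closed_segment_def)
    obtain q p where q: "0 \<le> q" "q \<le> 1" and p: "0 \<le> p" "p \<le> 1"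
      and xq: "x = (1 - q) *\<^sub>R A + q *\<^sub>R C - (p * l) *\<^sub>R u"
      and T: "\<And>p'. 0 \<le> p' \<Longrightarrow> p' \<le> p \<Longrightarrow> (1 - q) *\<^sub>R A + q *\<^sub>R C - (p' * l) *\<^sub>R u \<in> ?T"
      using T_form[OF x] by blast
    show "z \<in> ?T \<union> ?R"
    \<comment> \<open>The shift by \<open>s\<close> along \<open>u\<close> either reaches the edge
      \<open>A C\<close> and ends in the parallelogram, or stops short of it and ends in the
      triangle, with \<open>p - s / l\<close> in place of \<open>p\<close>.\<close>
    proof (cases "p * l \<le> s")
      case True
      have "z = ((1 - q) *\<^sub>R A + q *\<^sub>R C) + (s - p * l) *\<^sub>R u"
        by (simp add: z xq algebra_simps)
      moreover have "(1 - q) *\<^sub>R A + q *\<^sub>R C \<in> closed_segment A C"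
        using q by (auto simp: closed_segment_def)
      moreover have "0 \<le> p * l" using p l by simp
      then have "(s - p * l) *\<^sub>R u \<in> ?S"
        using s True unfolding closed_segment_def by force
      ultimately show ?thesis by (auto intro: set_plus_intro)
    next
      case False
      then have "l \<noteq> 0" using s by auto
      then have "0 < l" using l by simp
      then have "(p - s / l) * l = p * l - s" "0 \<le> p - s / l" "p - s / l \<le> p"
        using False s by (auto simp: field_simps)
      then show ?thesis using T[of "p - s / l"] by (simp add: z xq algebra_simps)
    qed
  next
    fix z assume "z \<in> ?T \<union> ?R"
    moreover have "?T \<subseteq> ?T + ?S"
      using set_plus_intro[of _ ?T 0 ?S] by auto
    moreover have "closed_segment A C \<subseteq> ?T"
      unfolding segment_convex_hull by (rule hull_mono) auto
    then have "?R \<subseteq> ?T + ?S" by (rule set_plus_mono2) simp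
    ultimately show "z \<in> ?T + ?S" by blast
  qed
  moreover have "negligible (?T \<inter> ?R)"
  proof (rule negligible_subset)
    have "C - A \<noteq> 0" using AC by auto
    then show "negligible {x. cross2 (C - A) x = cross2 (C - A) A}"
      by (rule negligible_cross2_level)
    show "?T \<inter> ?R \<subseteq> {x. cross2 (C - A) x = cross2 (C - A) A}"
    proof
      fix z assume z: "z \<in> ?T \<inter> ?R"
      obtain q p where p: "0 \<le> p"
        and zq: "z = (1 - q) *\<^sub>R A + q *\<^sub>R C - (p * l) *\<^sub>R u"
        using T_form[of z] z by blast
      obtain r s where s: "0 \<le> s" and zr: "z = (1 - r) *\<^sub>R A + r *\<^sub>R C + s *\<^sub>R u"
        using z by (auto simp: set_plus_def closed_segment_def)
      \<comment> \<open>\<open>cross2 u\<close> ignores shifts along \<open>u\<close> and is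
        injective on the line \<open>A C\<close>, so both descriptions of \<open>z\<close> start
        from the same edge point. The shifts have opposite signs, hence vanish, and \<open>z\<close>
        is on that line.\<close>
      have "cross2 u ((1 - q) *\<^sub>R A + q *\<^sub>R C - (p * l) *\<^sub>R u) =
          cross2 u ((1 - r) *\<^sub>R A + r *\<^sub>R C + s *\<^sub>R u)"
        using zq zr by simp
      then have "(q - r) * (cross2 u C - cross2 u A) = 0"
        by (simp add: cross2_simps algebra_simps)
      then have "q = r" using AC by simp
      then have "(s + p * l) *\<^sub>R u = 0" using zq zr by (simp add: algebra_simps)
      then have "s = 0" using u p l s by (auto simp: add_nonneg_eq_0_iff)
      then show "z \<in> {x. cross2 (C - A) x = cross2 (C - A) A}"
        by (simp add: zr cross2_def algebra_simps)
    qed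
  qed
  moreover have "?T \<in> lmeasurable" "?R \<in> lmeasurable"
    using lmeasurable_hull_plus_segment[of "{A, C}" 0 u]
    by (simp_all add: lmeasurable_compact finite_imp_compact_convex_hull segment_convex_hull)
  moreover have "measure lebesgue (?T \<inter> ?R) = 0"
    using \<open>negligible (?T \<inter> ?R)\<close> by (simp add: negligible_imp_measure0)
  ultimately show ?thesis
    using AC by (simp add: measure_Un3 measure_parallelogram cross2_simps)
qed

text \<open>If \<open>B\<close> lies behind the edge \<open>A C\<close> as seen along
  \<open>u\<close>, the auxiliary lemma applies directly; if it lies in front, it applies to
  \<open>- u\<close>.\<close>

lemma measure_triangle_plus_segment:
  fixes A B C u :: "real^2"
  assumes "cross2 u A \<le> cross2 u B" "cross2 u B \<le> cross2 u C"
  shows "measure lebesgue (convex hull {A, B, C} + closed_segment 0 u) =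
    measure lebesgue (convex hull {A, B, C}) + (cross2 u C - cross2 u A)"
proof (cases "u = 0")
  case True
  then show ?thesis by (simp add: cross2_def)
next
  case u: False
  let ?T = "convex hull {A, B, C}" and ?S = "closed_segment 0 u"
  show ?thesis
  proof (cases "cross2 u A = cross2 u C")
    case True
    \<comment> \<open>Triangle and sum both lie in one level line of \<open>cross2 u\<close>, so
      both areas are 0.\<close>
    then have eq: "cross2 u B = cross2 u A" "cross2 u C = cross2 u A" using assms by auto
    have *: "cross2 u (a *\<^sub>R A + b *\<^sub>R B + c *\<^sub>R C) = cross2 u A" if "a + b + c = 1" for a b c
      using that by (simp add: cross2_simps eq flip: distrib_right)
    have T: "?T \<subseteq> {x. cross2 u x = cross2 u A}"
      using * by (auto simp: convex_hull_3)
    then have TS: "?T + ?S \<subseteq> {x. cross2 u x = cross2 u A}"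
      by (auto simp: set_plus_def closed_segment_def cross2_simps)
    show ?thesis
      using negligible_subset[OF negligible_cross2_level[OF u] T]
        negligible_subset[OF negligible_cross2_level[OF u] TS] True
      by (simp add: negligible_imp_measure0)
  next
    case False
    then have AC: "cross2 u A < cross2 u C" using assms by simp
    \<comment> \<open>The point of \<open>A C\<close> with parameter \<open>m\<close> has the same
      \<open>cross2 u\<close> value as \<open>B\<close>, so it differs from \<open>B\<close> by a
      multiple of \<open>u\<close>.\<close>
    define m where "m = (cross2 u B - cross2 u A) / (cross2 u C - cross2 u A)"
    have m: "0 \<le> m" "m \<le> 1" using assms AC by (auto simp: m_def)
    have "m * (cross2 u C - cross2 u A) = cross2 u B - cross2 u A"
      using AC by (simp add: m_def)
    then have "cross2 u ((1 - m) *\<^sub>R A + m *\<^sub>R C - B) = 0"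
      by (simp add: cross2_simps algebra_simps)
    then obtain l where l: "(1 - m) *\<^sub>R A + m *\<^sub>R C - B = l *\<^sub>R u"
      using cross2_eq_0_imp_scaleR[OF u] by blast
    then have B: "B = (1 - m) *\<^sub>R A + m *\<^sub>R C - l *\<^sub>R u" by (simp add: algebra_simps)
    show ?thesis
    proof (cases "0 \<le> l")
      case True
      show ?thesis by (rule measure_triangle_plus_segment_aux[OF B m True AC])
    next
      case False
      \<comment> \<open>Up to a translation \<open>u\<close> may be replaced by \<open>- u\<close>.
        This makes the shift \<open>- l\<close> nonnegative, swaps the roles of \<open>A\<close> and
        \<open>C\<close> and turns \<open>m\<close> into \<open>1 - m\<close>.\<close>
      have "?S = (+) u ` closed_segment 0 (- u)"
        by (simp flip: closed_segment_translation add: closed_segment_commute)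
      then have "?T + ?S = (+) u ` (?T + closed_segment 0 (- u))"
        by (force simp: set_plus_def image_iff algebra_simps)
      then have "measure lebesgue (?T + ?S) = measure lebesgue (?T + closed_segment 0 (- u))"
        by (simp add: measure_translation)
      also have "\<dots> = measure lebesgue (convex hull {C, B, A} + closed_segment 0 (- u))"
        by (simp add: insert_commute)
      also have "\<dots> = measure lebesgue (convex hull {C, B, A}) +
          (cross2 (- u) A - cross2 (- u) C)"
        by (rule measure_triangle_plus_segment_aux[where m = "1 - m" and l = "- l"])
          (use B m False AC in \<open>auto simp: cross2_simps algebra_simps\<close>)
      finally show ?thesis by (simp add: cross2_simps insert_commute)
    qed
  qed
qed

section \<open>Mixed areas with segments\<close>

lemma measure_segment_eq_0:
  fixes u :: "real^2"
  shows "measure lebesgue (closed_segment 0 u) = 0"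
  using measure_parallelogram[of 0 0 u] by (simp add: cross2_simps)

lemma mixed_area_commute: "mixed_area P Q = mixed_area Q P"
  by (simp add: mixed_area_def add.commute)

lemma mixed_area_segment_triangle:
  assumes "cross2 u A \<le> cross2 u B" "cross2 u B \<le> cross2 u C"
  shows "mixed_area (closed_segment 0 u) (convex hull {A, B, C}) = cross2 u C - cross2 u A"
  using measure_triangle_plus_segment[OF assms]
  by (simp add: mixed_area_def Vol2_def measure_segment_eq_0 add.commute)

lemma mixed_area_segments:
  "mixed_area (closed_segment 0 u) (closed_segment 0 w) = \<bar>cross2 w u\<bar>"
  by (simp add: mixed_area_def Vol2_def measure_segment_eq_0 measure_parallelogram)

section \<open>Lattice polytopes and relabelling of the nodes\<close>

lemma lattice_polytope_segment:
  assumes "x \<in> \<int>" "y \<in> \<int>"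
  shows "lattice_polytope (closed_segment 0 (vector [x, y]))"
  unfolding lattice_polytope_def segment_convex_hull
  by (rule exI[of _ "{0, vector [x, y]}"]) (use assms in \<open>auto simp: forall_2\<close>)

lemma Vsf42I:
  assumes ijkl: "{1..4} = {i, j, k, l}" "distinct [i, j, k, l]"
    and "lattice_polytope P" "lattice_polytope Q" "lattice_polytope R" "lattice_polytope S"
    and "v {i, j} = mixed_area P Q" "v {i, k} = mixed_area P R" "v {i, l} = mixed_area P S"
    and "v {j, k} = mixed_area Q R" "v {j, l} = mixed_area Q S" "v {k, l} = mixed_area R S"
  shows "v \<in> Vsf42"
proof -
  let ?P = "\<lambda>n. if n = i then P else if n = j then Q else if n = k then R else S"
  \<comment> \<open>The labels come in no fixed numerical order, so each of the six equations is
    needed for both orders of its pair.\<close>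
  have flip: "v {n, m} = mixed_area Y X" if "v {m, n} = mixed_area X Y" for m n X Y
    using that by (simp only: insert_commute mixed_area_commute)
  note vs = assms(7-12) assms(7-12)[THEN flip]
  have ne: "i \<noteq> j" "i \<noteq> k" "i \<noteq> l" "j \<noteq> k" "j \<noteq> l" "k \<noteq> l"
    using ijkl(2) by auto
  have lattice: "\<forall>n\<in>{i, j, k, l}. lattice_polytope (?P n)"
    using assms(3-6) by simp
  have mixed: "\<forall>m\<in>{i, j, k, l}. \<forall>n\<in>{i, j, k, l}. m \<noteq> n \<longrightarrow> v {m, n} = mixed_area (?P m) (?P n)"
    by (simp only: ball_simps vs ne ne[symmetric] if_True if_False simp_thms)
  show ?thesis
    unfolding Vsf42_def ijkl(1)
  proof (intro CollectI exI[of _ ?P] conjI ballI impI)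
    show "lattice_polytope (?P n)" if "n \<in> {i, j, k, l}" for n
      using lattice that by (rule bspec)
    show "v {m, n} = mixed_area (?P m) (?P n)"
      if "m \<in> {i, j, k, l}" "n \<in> {i, j, k, l}" "m < n" for m n
      using that by (rule mixed[rule_format, OF _ _ less_imp_neq])
  qed
qed

text \<open>The three inequalities correspond to the three perfect matchings of the complete graph,
  which a relabelling permutes.\<close>

lemma Pl42_relabel:
  assumes "v \<in> Pl42" "{1..4} = {i, j, k, l}" "distinct [i, j, k, l]"
  shows "v {i, j} \<in> \<int>" "0 \<le> v {i, j}"
    "v {i, j} * v {k, l} \<le> v {i, k} * v {j, l} + v {i, l} * v {j, k}"
proof -
  have ijkl: "i \<in> {1..4}" "j \<in> {1..4}" "k \<in> {1..4}" "l \<in> {1..4}"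
    unfolding assms(2) by simp_all
  have ne: "i \<noteq> j" "i \<noteq> k" "i \<noteq> l" "j \<noteq> k" "j \<noteq> l" "k \<noteq> l"
    using assms(3) by auto
  have v: "v {m, n} \<in> \<int> \<and> 0 \<le> v {m, n}" if "m \<in> {1..4}" "n \<in> {1..4}" "m < n" for m n
    using assms(1) that by (auto simp: Pl42_def)
  show "v {i, j} \<in> \<int>" "0 \<le> v {i, j}"
    using v[of i j] v[of j i] ijkl(1,2) ne(1) insert_commute[of i j "{}"]
    by (cases "i < j"; simp)+
  define I where "I i j k l \<longleftrightarrow>
    v {i, j} * v {k, l} \<le> v {i, k} * v {j, l} + v {i, l} * v {j, k}" for i j k l
  have sym: "I j i k l = I i j k l" "I i j l k = I i j k l" "I k l i j = I i j k l" for i j k l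
    by (simp_all only: I_def insert_commute mult.commute add.commute)
  have base: "I 1 2 3 4" "I 1 3 2 4" "I 1 4 2 3"
    using assms(1) by (simp_all add: I_def Pl42_def insert_commute algebra_simps)
  \<comment> \<open>\<open>I i j k l\<close> depends only on the matching of \<open>{i, j}\<close>
    with \<open>{k, l}\<close>. Sorting within and between the pairs forces \<open>i = 1\<close> and
    leaves the three base cases; the order assumptions are then removed one after another.\<close>
  have sorted: "I i j k l" if "i < j" "k < l" "i < k" "j \<noteq> k" "j \<noteq> l"
    "i \<in> {1..4}" "j \<in> {1..4}" "l \<in> {1..4}" for i j k l
  proof -
    have "1 \<le> i" "j \<le> 4" "l \<le> 4" using that by auto
    then have "i = 1 \<and> (j = 2 \<and> k = 3 \<and> l = 4 \<or> j = 3 \<and> k = 2 \<and> l = 4 \<or> j = 4 \<and> k = 2 \<and> l = 3)"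
      using that(1-5) by linarith
    then show ?thesis using base by blast
  qed
  have increasing: "I i j k l" if "i < j" "k < l" "i \<noteq> k" "i \<noteq> l" "j \<noteq> k" "j \<noteq> l"
    "i \<in> {1..4}" "j \<in> {1..4}" "k \<in> {1..4}" "l \<in> {1..4}" for i j k l
    using sorted[of i j k l] sorted[of k l i j] sym(3)[of k l i j] that
    by (cases "i < k") (simp_all only: not_less_iff_gr_or_eq simp_thms)
  have "I i j k l"
    using increasing[of i j k l] increasing[of j i k l] increasing[of i j l k]
      increasing[of j i l k] sym(1)[of j i] sym(2)[of i j l k] ijkl ne
    by (metis linorder_neqE_nat)
  then show "v {i, j} * v {k, l} \<le> v {i, k} * v {j, l} + v {i, l} * v {j, k}"
    by (simp only: I_def)
qed

section \<open>The realising segments and triangle\<close>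

lemma Vsf42_ordered:
  assumes v: "v \<in> Pl42" and ijkl: "{1..4} = {i, j, k, l}" "distinct [i, j, k, l]"
    and 1: "v {i, j} = 1" "v {i, k} = 1" and le: "v {j, l} \<le> v {k, l}"
  shows "v \<in> Vsf42"
proof -
  define a b c d where "a = v {i, l}" and "b = v {j, l}" and "c = v {k, l}" and "d = v {j, k}"
  note abcd = a_def b_def c_def d_def
  have perms: "{1..4} = {i, l, j, k}" "{1..4} = {j, l, i, k}" "{1..4} = {k, l, i, j}"
    "{1..4} = {j, k, i, l}"
    using ijkl(1) by (simp_all only: insert_commute)
  have dist: "distinct [i, l, j, k]" "distinct [j, l, i, k]" "distinct [k, l, i, j]"
    "distinct [j, k, i, l]"
    using ijkl(2) by auto
  note relabel = Pl42_relabel(1,2)[OF v perms(1) dist(1)] Pl42_relabel(1,2)[OF v perms(2) dist(2)]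
    Pl42_relabel(1,2)[OF v perms(3) dist(3)] Pl42_relabel(1,2)[OF v perms(4) dist(4)]
  have int: "a \<in> \<int>" "b \<in> \<int>" "c \<in> \<int>" "d \<in> \<int>"
    and nonneg: "0 \<le> a" "0 \<le> b" "0 \<le> c" "0 \<le> d"
    unfolding abcd by (fact relabel)+
  have bc: "b \<le> c" using le by (simp add: abcd)
  have tri: "c \<le> b + a * d" "a * d \<le> b + c"
    using Pl42_relabel(3)[OF v perms(3) dist(3)] Pl42_relabel(3)[OF v perms(1) dist(1)] 1
    by (simp_all add: abcd insert_commute mult.commute)
  \<comment> \<open>On \<open>?A\<close>, \<open>?B\<close>, \<open>?C\<close> the form
    \<open>cross2 ?f\<close> takes the values \<open>0\<close>, \<open>- t\<close>,
    \<open>a * d - c\<close>. If \<open>c \<le> a * d\<close>, the extremes are at \<open>?B\<close>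
    and \<open>?C\<close>, and width \<open>b\<close> forces \<open>t = b + c - a * d\<close>;
    otherwise they are at \<open>?B\<close> and \<open>?A\<close>, and \<open>t = b\<close>. The
    bound \<open>t \<le> c\<close> keeps the horizontal width equal to \<open>c\<close>.\<close>
  define t where "t = (if c \<le> a * d then b + c - a * d else b)"
  have t: "0 \<le> t" "t \<le> c" "t \<in> \<int>"
    using tri bc nonneg int by (auto simp: t_def)
  let ?e = "vector [1, 0] :: real^2" and ?f = "vector [d, 1] :: real^2"
    and ?g = "vector [0, 1] :: real^2"
  let ?A = "0 :: real^2" and ?B = "vector [t, 0] :: real^2" and ?C = "vector [c, a] :: real^2"
  \<comment> \<open>The width formula wants the vertices sorted by the form: these are the orders
    for \<open>?f\<close> in the first case, for \<open>?g\<close>, and for \<open>?f\<close> in the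
    second case.\<close>
  have hull: "convex hull {?B, ?A, ?C} = convex hull {?A, ?B, ?C}"
    "convex hull {?C, ?B, ?A} = convex hull {?A, ?B, ?C}"
    "convex hull {?B, ?C, ?A} = convex hull {?A, ?B, ?C}"
    by (simp_all add: insert_commute)
  show ?thesis
  proof (rule Vsf42I[OF ijkl])
    show "lattice_polytope (closed_segment 0 ?e)" "lattice_polytope (closed_segment 0 ?f)"
      "lattice_polytope (closed_segment 0 ?g)"
      using int by (auto intro: lattice_polytope_segment)
    show "lattice_polytope (convex hull {?A, ?B, ?C})"
      unfolding lattice_polytope_def
      by (rule exI[of _ "{?A, ?B, ?C}"]) (use int t in \<open>auto simp: forall_2\<close>)
    show "v {i, j} = mixed_area (closed_segment 0 ?e) (closed_segment 0 ?f)"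
      "v {i, k} = mixed_area (closed_segment 0 ?e) (closed_segment 0 ?g)"
      "v {j, k} = mixed_area (closed_segment 0 ?f) (closed_segment 0 ?g)"
      using 1 nonneg by (simp_all add: mixed_area_segments cross2_def abcd)
    show "v {i, l} = mixed_area (closed_segment 0 ?e) (convex hull {?A, ?B, ?C})"
      using nonneg by (subst mixed_area_segment_triangle) (auto simp: cross2_def abcd)
    show "v {k, l} = mixed_area (closed_segment 0 ?g) (convex hull {?A, ?B, ?C})"
      unfolding hull(2)[symmetric] using t
      by (subst mixed_area_segment_triangle) (auto simp: cross2_def abcd)
    show "v {j, l} = mixed_area (closed_segment 0 ?f) (convex hull {?A, ?B, ?C})"
    proof (cases "c \<le> a * d")
      case True
      then have "mixed_area (closed_segment 0 ?f) (convex hull {?B, ?A, ?C}) = b"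
        using t by (subst mixed_area_segment_triangle) (auto simp: cross2_def t_def mult.commute)
      then show ?thesis by (simp add: hull b_def)
    next
      case False
      \<comment> \<open>Here \<open>tri\<close> gives \<open>c - a * d \<le> b = t\<close>, which
        puts the value at \<open>?C\<close> between those at \<open>?B\<close> and
        \<open>?A\<close>.\<close>
      then have "mixed_area (closed_segment 0 ?f) (convex hull {?B, ?C, ?A}) = b"
        using t tri by (subst mixed_area_segment_triangle) (auto simp: cross2_def t_def mult.commute)
      then show ?thesis by (simp add: hull b_def)
    qed
  qed
qed

theorem theorem7p1:
  fixes v :: coeffs and i j k :: nat
  assumes "v \<in> interior_Pl42"
    and "i \<in> {1..4}" and "j \<in> {1..4}" and "k \<in> {1..4}"
    and "i \<noteq> j" and "i \<noteq> k" and "j \<noteq> k"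
    and "v {i, j} = 1" and "v {i, k} = 1"
  shows "v \<in> Vsf42"
proof -
  have v: "v \<in> Pl42" using assms(1) by (simp add: interior_Pl42_def)
  have "card ({1..4} - {i, j, k}) = 1"
    using assms by (subst card_Diff_subset) auto
  then obtain l where l: "{1..4} - {i, j, k} = {l}" by (auto simp: card_1_singleton_iff)
  have "{1..4} = {i, j, k, l}" "{1..4} = {i, k, j, l}"
    using l assms(2-4) by blast+
  moreover have "l \<notin> {i, j, k}" using l by blast
  then have "distinct [i, j, k, l]" "distinct [i, k, j, l]" using assms(5-7) by simp_all
  \<comment> \<open>Exchanging \<open>j\<close> and \<open>k\<close> provides the order of
    \<open>v {j, l}\<close> and \<open>v {k, l}\<close> that the construction assumes.\<close>
  ultimately show ?thesis
    using Vsf42_ordered[OF v, of i j k l] Vsf42_ordered[OF v, of i k j l] assms(8,9)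
    by linarith
qed

end
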